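(* For every positive integer $n$, we have $\operatorname{inv}(n) \leq n - \lceil \log_2 (n+1) \rceil$, where $\operatorname{inv}(n)$ denotes the maximum of $\operatorname{inv}(D)$ over all oriented graphs $D$ of order $n$.
   Context: All graphs are finite. An oriented graph is a digraph without loops and with at most one arc between any two vertices. For an oriented graph $D$ and a set $X\subseteq V(D)$, the inversion of $X$ in $D$ consists in reversing the direction of all arcs of $D$ with both end-vertices in $X$. For a finite family $(X_i)_{i\in I}$ of subsets of $V(D)$, $\operatorname{Inv}(D;(X_i)_{i\in I})$ is the oriented graph obtained by inverting the $X_i$ one after another (the order is irrelevant: an arc is reversed if and only if an odd number of the $X_i$ contain both its end-vertices). The family is a decycling family of $D$ if the resulting oriented graph is acyclic (has no directed cycle). The inversion number $\operatorname{inv}(D)$ is the minimum cardinality of a decycling family of $D$. The order of $D$ is its number of vertices. *)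

theory Defs
  imports Complex_Main "Graph_Theory.Pair_Digraph"
begin

locale oriented_graph = pair_digraph D for D :: "'a pair_pre_digraph" +
  assumes no_antiparallel: "(u, v) \<in> parcs D \<Longrightarrow> (v, u) \<notin> parcs D"

definition acyclic_digraph :: "'a pair_pre_digraph \<Rightarrow> bool" where
  "acyclic_digraph D \<longleftrightarrow> \<not> (\<exists>p. pre_digraph.cycle (with_proj D) p)"

definition invert :: "'a pair_pre_digraph \<Rightarrow> 'a set \<Rightarrow> 'a pair_pre_digraph" where
  "invert D X = D\<lparr> parcs := (\<lambda>(u, v). if u \<in> X \<and> v \<in> X then (v, u) else (u, v)) ` parcs D \<rparr>"

text \<open>
  A finite family of vertex sets is given as a list (its members may coincide); its cardinality
  is the length of the list.
\<close>

definition Inv :: "'a pair_pre_digraph \<Rightarrow> 'a set list \<Rightarrow> 'a pair_pre_digraph" where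
  "Inv D Xs = foldl invert D Xs"

definition decycling_family :: "'a pair_pre_digraph \<Rightarrow> 'a set list \<Rightarrow> bool" where
  "decycling_family D Xs \<longleftrightarrow> (\<forall>X\<in>set Xs. X \<subseteq> pverts D) \<and> acyclic_digraph (Inv D Xs)"

definition inv_number :: "'a pair_pre_digraph \<Rightarrow> nat" where
  "inv_number D = (LEAST k. \<exists>Xs. decycling_family D Xs \<and> length Xs = k)"

text \<open>
  The maximum is taken over graphs whose vertices are natural numbers. Every finite oriented graph
  is isomorphic to one of these; lemma \<open>inv_number_le_max_inv_number\<close> below shows that nothing
  is lost by this choice.
\<close>

definition max_inv_number :: "nat \<Rightarrow> nat" where
  "max_inv_number n =
    Max {inv_number D | D :: nat pair_pre_digraph. oriented_graph D \<and> card (pverts D) = n}"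


subsection \<open>The minimum and the maximum exist\<close>

lemma pverts_invert [simp]: "pverts (invert D X) = pverts D"
  by (simp add: invert_def)

lemma parcs_invert:
  "(a, b) \<in> parcs (invert D X) \<longleftrightarrow>
    (if a \<in> X \<and> b \<in> X then (b, a) \<in> parcs D else (a, b) \<in> parcs D)"
  by (auto simp: invert_def image_iff split: if_splits prod.splits)

lemma (in oriented_graph) oriented_graph_invert: "oriented_graph (invert D X)"
proof
  show "fst e \<in> pverts (invert D X)" "snd e \<in> pverts (invert D X)" "fst e \<noteq> snd e"
    if "e \<in> parcs (invert D X)" for e
    using that in_arcsD1 in_arcsD2 pair_no_loops
    by (cases e; force simp: parcs_invert split: if_splits)+
  show "finite (pverts (invert D X))"
    by (simp add: pair_finite_verts)
  show "finite (parcs (invert D X))"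
    by (simp add: invert_def pair_finite_arcs)
  show "(v, u) \<notin> parcs (invert D X)" if "(u, v) \<in> parcs (invert D X)" for u v
    using that no_antiparallel by (auto simp: parcs_invert split: if_splits)
qed

lemma (in pair_wf_digraph) acyclic_digraph_iff: "acyclic_digraph G \<longleftrightarrow> acyclic (parcs G)"
proof
  assume L: "acyclic_digraph G"
  show "acyclic (parcs G)"
  proof (rule acyclicI, intro allI notI)
    fix x assume "(x, x) \<in> (parcs G)\<^sup>+"
    then obtain p where "awalk x p x" "p \<noteq> []"
      using reachable1_awalk[of x x] by auto
    then have "closed_w p" by (auto simp: closed_w_def)
    from closed_w_imp_cycle[OF this] L show False by (auto simp: acyclic_digraph_def)
  qed
next
  assume R: "acyclic (parcs G)"
  show "acyclic_digraph G"
    unfolding acyclic_digraph_def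
  proof
    assume "\<exists>p. cycle p"
    then obtain p u where "awalk u p u" "p \<noteq> []" by (auto simp: cycle_def)
    then have "(u, u) \<in> (parcs G)\<^sup>+" using reachable1_awalk[of u u] by auto
    with R show False by (auto simp: acyclic_def)
  qed
qed

lemma oriented_graph_Inv: "oriented_graph D \<Longrightarrow> oriented_graph (Inv D Xs)"
  by (induction Xs arbitrary: D) (auto simp: Inv_def oriented_graph.oriented_graph_invert)

lemma acyclic_Inv_iff:
  "oriented_graph D \<Longrightarrow> acyclic_digraph (Inv D Xs) \<longleftrightarrow> acyclic (parcs (Inv D Xs))"
  using oriented_graph_Inv[of D Xs] pair_wf_digraph.acyclic_digraph_iff
  by (auto simp: oriented_graph_def pair_digraph_def pair_fin_digraph_def)

lemma decycling_family_bounded: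
  fixes f :: "'a \<Rightarrow> nat"
  assumes "oriented_graph D" and "inj_on f (pverts D)"
  shows "\<exists>Xs. decycling_family D Xs \<and> length Xs \<le> card {(u, v) \<in> parcs D. f v < f u}"
  using assms
proof (induction "card {(u, v) \<in> parcs D. f v < f u}" arbitrary: D rule: less_induct)
  case less
  interpret oriented_graph D by (fact less.prems(1))
  let ?B = "\<lambda>D. {(u, v) \<in> parcs D. f v < f u}"
  have fin: "finite (?B D)"
    by (rule finite_subset[OF _ pair_finite_arcs]) auto
  show ?case
  proof (cases "?B D = {}")
    case True
    have "f u < f v" if "(u, v) \<in> parcs D" for u v
    proof -
      have "u \<noteq> v" using pair_no_loops[OF that] by simp
      then have "f u \<noteq> f v"
        using less.prems(2) in_arcsD1[OF that] in_arcsD2[OF that] by (auto dest: inj_onD)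
      moreover have "\<not> f v < f u" using True that by auto
      ultimately show ?thesis by simp
    qed
    then have "parcs D \<subseteq> measure f" by auto
    then have "acyclic (parcs D)"
      using wf_acyclic[OF wf_measure] acyclic_subset by blast
    then have "acyclic_digraph (Inv D [])"
      by (simp add: Inv_def acyclic_digraph_iff)
    then show ?thesis
      by (intro exI[of _ "[]"]) (simp add: decycling_family_def)
  next
    case False
    then obtain u v where uv: "(u, v) \<in> parcs D" "f v < f u" by auto
    let ?D = "invert D {u, v}"
    have "?B ?D \<subseteq> ?B D - {(u, v)}"
      using uv no_antiparallel pair_no_loops by (auto simp: parcs_invert split: if_splits)
    moreover have "(u, v) \<in> ?B D" using uv by simp
    ultimately have lt: "card (?B ?D) < card (?B D)"
      using fin by (meson card_Diff1_less card_mono finite_Diff le_less_trans)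
    from less.hyps[OF lt oriented_graph_invert] less.prems(2)
    obtain Xs where Xs: "decycling_family ?D Xs" "length Xs \<le> card (?B ?D)" by auto
    have "decycling_family D ({u, v} # Xs)"
      using Xs(1) in_arcsD1[OF uv(1)] in_arcsD2[OF uv(1)]
      by (auto simp: decycling_family_def Inv_def)
    moreover have "length ({u, v} # Xs) \<le> card (?B D)"
      using Xs(2) lt by simp
    ultimately show ?thesis by blast
  qed
qed

lemma inv_number_bounded:
  assumes "oriented_graph D"
  shows "\<exists>Xs. decycling_family D Xs \<and> length Xs = inv_number D"
    and "inv_number D \<le> card (pverts D) * card (pverts D)"
proof -
  interpret oriented_graph D by fact
  obtain f :: "_ \<Rightarrow> nat" where "inj_on f (pverts D)"
    using finite_imp_inj_to_nat_seg[OF pair_finite_verts] by blast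
  from decycling_family_bounded[OF assms this] obtain Xs where
    Xs: "decycling_family D Xs" "length Xs \<le> card {(u, v) \<in> parcs D. f v < f u}" by blast
  have ex: "\<exists>k Xs. decycling_family D Xs \<and> length Xs = k" using Xs(1) by blast
  from LeastI_ex[OF ex] show "\<exists>Xs. decycling_family D Xs \<and> length Xs = inv_number D"
    unfolding inv_number_def .
  have "inv_number D \<le> length Xs"
    unfolding inv_number_def using Xs(1) by (intro Least_le) blast
  also have "\<dots> \<le> card (pverts D \<times> pverts D)"
    using Xs(2) in_arcsD1 in_arcsD2 pair_finite_verts
    by (elim order_trans, intro card_mono) auto
  finally show "inv_number D \<le> card (pverts D) * card (pverts D)"
    by (simp add: card_cartesian_product)
qed

lemma inv_number_values:
  fixes n :: nat
  defines "S \<equiv> {inv_number D | D :: nat pair_pre_digraph. oriented_graph D \<and> card (pverts D) = n}"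
  shows "finite S" and "S \<noteq> {}"
proof -
  have "S \<subseteq> {..n * n}" using inv_number_bounded(2) by (auto simp: S_def)
  then show "finite S" by (rule finite_subset) simp
  have "oriented_graph \<lparr> pverts = {..<n}, parcs = {} \<rparr>" by unfold_locales auto
  then show "S \<noteq> {}" by (force simp: S_def)
qed

lemma inv_number_le_max_inv_number:
  fixes D :: "'a pair_pre_digraph"
  assumes "oriented_graph D"
  shows "inv_number D \<le> max_inv_number (card (pverts D))"
proof -
  interpret oriented_graph D by fact
  obtain f :: "'a \<Rightarrow> nat" where f: "inj_on f (pverts D)"
    using finite_imp_inj_to_nat_seg[OF pair_finite_verts] by blast
  define E where "E = \<lparr> pverts = f ` pverts D, parcs = map_prod f f ` parcs D \<rparr>"
  have E: "oriented_graph E"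
  proof
    show "fst e \<in> pverts E" "snd e \<in> pverts E" if "e \<in> parcs E" for e
      using that in_arcsD1 in_arcsD2 by (auto simp: E_def)
    show "fst e \<noteq> snd e" if e: "e \<in> parcs E" for e
    proof -
      obtain u v where "(u, v) \<in> parcs D" "e = (f u, f v)" using e by (auto simp: E_def)
      then show ?thesis
        using f pair_no_loops[of "(u, v)"] by (auto dest: inj_onD in_arcsD1 in_arcsD2)
    qed
    show "finite (pverts E)" "finite (parcs E)"
      by (auto simp: E_def pair_finite_verts pair_finite_arcs)
    show "(b, a) \<notin> parcs E" if ab: "(a, b) \<in> parcs E" for a b
    proof
      assume "(b, a) \<in> parcs E"
      then obtain u v u' v' where *: "(u, v) \<in> parcs D" "(v', u') \<in> parcs D"
        "f u = f u'" "f v = f v'" using ab by (auto simp: E_def)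
      then have "u = u'" "v = v'" using f by (meson inj_onD in_arcsD1 in_arcsD2)+
      then show False using * no_antiparallel by blast
    qed
  qed
  obtain Ys where Ys: "decycling_family E Ys" "length Ys = inv_number E"
    using inv_number_bounded(1)[OF E] by blast
  let ?pull = "\<lambda>Y. pverts D \<inter> f -` Y"
  have hom: "map_prod f f ` parcs (Inv D' (map ?pull Zs)) \<subseteq> parcs (Inv E' Zs)"
    if "oriented_graph D'" "pverts D' = pverts D" "map_prod f f ` parcs D' \<subseteq> parcs E'"
    for Zs D' E'
    using that
  proof (induction Zs arbitrary: D' E')
    case Nil
    then show ?case by (simp add: Inv_def)
  next
    case (Cons Z Zs)
    interpret D': oriented_graph D' by (fact Cons.prems(1))
    have "map_prod f f ` parcs (invert D' (?pull Z)) \<subseteq> parcs (invert E' Z)"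
    proof (rule image_subsetI)
      fix e assume "e \<in> parcs (invert D' (?pull Z))"
      then obtain a b where e: "e = (a, b)" and ab: "(a, b) \<in> parcs (invert D' (?pull Z))"
        by (cases e) auto
      then have "a \<in> pverts D" "b \<in> pverts D"
        using D'.in_arcsD1 D'.in_arcsD2 Cons.prems(2)
        by (auto simp: parcs_invert split: if_splits)
      then show "map_prod f f e \<in> parcs (invert E' Z)"
        using e ab Cons.prems(3) by (force simp: parcs_invert split: if_splits)
    qed
    from Cons.IH[OF D'.oriented_graph_invert _ this] Cons.prems(2) show ?case
      by (simp add: Inv_def)
  qed
  have sub: "map_prod f f ` parcs (Inv D (map ?pull Ys)) \<subseteq> parcs (Inv E Ys)"
    by (rule hom[OF assms]) (simp_all add: E_def)
  have tr: "(f a, f b) \<in> (parcs (Inv E Ys))\<^sup>+"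
    if "(a, b) \<in> (parcs (Inv D (map ?pull Ys)))\<^sup>+" for a b
    using that
  proof (induction rule: trancl_induct)
    case (base y)
    then show ?case using sub by force
  next
    case (step y z)
    have "(f y, f z) \<in> parcs (Inv E Ys)" using step.hyps(2) sub by force
    with step.IH show ?case by (rule trancl_into_trancl)
  qed
  have "acyclic (parcs (Inv E Ys))"
    using Ys(1) acyclic_Inv_iff[OF E] by (simp add: decycling_family_def)
  then have "acyclic (parcs (Inv D (map ?pull Ys)))"
    using tr by (auto simp: acyclic_def)
  then have dec: "decycling_family D (map ?pull Ys)"
    using acyclic_Inv_iff[OF assms] by (auto simp: decycling_family_def)
  have "inv_number D \<le> inv_number E"
    unfolding inv_number_def[of D] using dec Ys(2)
    by (intro Least_le exI[of _ "map ?pull Ys"]) simp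
  also have "\<dots> \<le> max_inv_number (card (pverts E))"
    unfolding max_inv_number_def using E by (intro Max_ge inv_number_values) auto
  also have "card (pverts E) = card (pverts D)"
    using f by (simp add: E_def card_image)
  finally show ?thesis .
qed

end

theory Submission
  imports Defs
begin

text \<open>
  Induct on the number of vertices. Some vertex \<open>x\<close> has a set \<open>B\<close> of in-neighbours with
  \<open>2 * card B < n\<close>. Inverting the closed in-neighbourhood of a vertex \<open>b \<in> B\<close> makes \<open>b\<close> a source,
  so that \<open>b\<close> may be deleted; since \<open>b\<close> dominates \<open>x\<close>, this inversion does not involve \<open>x\<close>, so the
  in-neighbours of \<open>x\<close> become \<open>B - {b}\<close>. After \<open>card B\<close> inversions \<open>x\<close> itself is a source and is
  deleted for free, leaving at least \<open>n div 2\<close> vertices. Each round thus gains one inversion over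
  the trivial bound \<open>n\<close> while at worst halving the number of vertices.
\<close>

text \<open>Inversion on bare relations: deleting a vertex then only shrinks a vertex set and leaves
  the relation alone.\<close>

definition reverse_within :: "'a rel \<Rightarrow> 'a set \<Rightarrow> 'a rel" where
  "reverse_within r X = {(a, b). if a \<in> X \<and> b \<in> X then (b, a) \<in> r else (a, b) \<in> r}"

lemma mem_reverse_within:
  "(a, b) \<in> reverse_within r X \<longleftrightarrow> (if a \<in> X \<and> b \<in> X then (b, a) \<in> r else (a, b) \<in> r)"
  by (simp add: reverse_within_def)

lemma asym_reverse_within: "asym r \<Longrightarrow> asym (reverse_within r X)"
  by (auto simp: mem_reverse_within intro!: asymI dest: asymD split: if_splits)

lemma mem_foldl_reverse_within_iff:
  "\<forall>X\<in>set Xs. a \<notin> X \<or> b \<notin> X \<Longrightarrow> (a, b) \<in> foldl reverse_within r Xs \<longleftrightarrow> (a, b) \<in> r"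
  by (induction Xs arbitrary: r) (auto simp: mem_reverse_within)

lemma parcs_Inv: "parcs (Inv D Xs) = foldl reverse_within (parcs D) Xs"
proof (induction Xs arbitrary: D)
  case (Cons X Xs)
  have "parcs (invert D X) = reverse_within (parcs D) X"
    by (auto simp: parcs_invert mem_reverse_within)
  with Cons[of "invert D X"] show ?case by (simp add: Inv_def)
qed (simp add: Inv_def)

text \<open>A walk inside \<open>V\<close> that starts off \<open>v\<close> can never enter
  \<open>v\<close>, and no cycle passes through \<open>v\<close>; so a cycle in \<open>V\<close>
  would already lie in \<open>V - {v}\<close>.\<close>

lemma acyclic_add_source:
  assumes "acyclic (r \<inter> (V - {v}) \<times> (V - {v}))" and "\<forall>u\<in>V. (u, v) \<notin> r"
  shows "acyclic (r \<inter> V \<times> V)"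
proof (rule acyclicI, intro allI notI)
  fix y assume y: "(y, y) \<in> (r \<inter> V \<times> V)\<^sup>+"
  have "(a, b) \<in> (r \<inter> (V - {v}) \<times> (V - {v}))\<^sup>+" if "(a, b) \<in> (r \<inter> V \<times> V)\<^sup>+" "a \<noteq> v" for a b
    using that
  proof (induction rule: trancl_induct)
    case (base b)
    then show ?case using assms(2) by auto
  next
    case (step b c)
    from step.IH[OF step.prems] have "b \<noteq> v" by (auto elim: tranclE)
    then have "(b, c) \<in> r \<inter> (V - {v}) \<times> (V - {v})" using step.hyps(2) assms(2) by auto
    with step.IH[OF step.prems] show ?case by (rule trancl_into_trancl)
  qed
  moreover have "y \<noteq> v" using y assms(2) by (auto elim: tranclE)
  ultimately show False using y assms(1) by (auto simp: acyclic_def)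
qed

definition decyclable_within :: "'a set \<Rightarrow> 'a rel \<Rightarrow> nat \<Rightarrow> bool" where
  "decyclable_within V r m \<longleftrightarrow>
    (\<exists>Xs. (\<forall>X\<in>set Xs. X \<subseteq> V) \<and> length Xs = m \<and> acyclic (foldl reverse_within r Xs \<inter> V \<times> V))"

text \<open>The sets chosen inside \<open>V - {v}\<close> reverse no pair at \<open>v\<close>, so
  \<open>v\<close> is still a source after all inversions.\<close>

lemma decyclable_within_add_source:
  assumes "decyclable_within (V - {v}) r m" and "\<forall>u\<in>V. (u, v) \<notin> r"
  shows "decyclable_within V r m"
proof -
  from assms(1) obtain Xs where Xs: "\<forall>X\<in>set Xs. X \<subseteq> V - {v}" "length Xs = m"
    "acyclic (foldl reverse_within r Xs \<inter> (V - {v}) \<times> (V - {v}))"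
    by (auto simp: decyclable_within_def)
  have "(u, v) \<in> foldl reverse_within r Xs \<longleftrightarrow> (u, v) \<in> r" for u
    using Xs(1) by (intro mem_foldl_reverse_within_iff) auto
  with assms(2) have "acyclic (foldl reverse_within r Xs \<inter> V \<times> V)"
    by (intro acyclic_add_source[OF Xs(3)]) simp
  with Xs(1,2) show ?thesis unfolding decyclable_within_def by blast
qed

lemma decyclable_within_Suc:
  assumes "decyclable_within V (reverse_within r X) m" and "X \<subseteq> V"
  shows "decyclable_within V r (Suc m)"
proof -
  from assms(1) obtain Xs where "\<forall>Y\<in>set Xs. Y \<subseteq> V" "length Xs = m"
    "acyclic (foldl reverse_within (reverse_within r X) Xs \<inter> V \<times> V)"
    by (auto simp: decyclable_within_def)
  with assms(2) show ?thesis
    unfolding decyclable_within_def by (intro exI[of _ "X # Xs"]) auto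
qed

text \<open>Each pair into \<open>b\<close> is turned around, while by asymmetry no out-neighbour of
  \<open>b\<close> lies in the inverted set; hence \<open>b\<close> becomes a source.\<close>

lemma decyclable_within_delete_vertex:
  assumes "asym r" and "b \<in> V"
    and "decyclable_within (V - {b}) (reverse_within r (insert b {u \<in> V. (u, b) \<in> r})) m"
  shows "decyclable_within V r (Suc m)"
proof -
  have "\<forall>u\<in>V. (u, b) \<notin> reverse_within r (insert b {u \<in> V. (u, b) \<in> r})"
    using asymD[OF assms(1)] by (auto simp: mem_reverse_within)
  from decyclable_within_add_source[OF assms(3) this] show ?thesis
    by (rule decyclable_within_Suc) (use assms(2) in auto)
qed

text \<open>Induction on \<open>card B\<close>; \<open>A\<close> stays fixed while \<open>V\<close>,
  \<open>r\<close> and \<open>B\<close> change. The inversions may alter \<open>r\<close> on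
  \<open>A\<close> unpredictably, so the last hypothesis covers every asymmetric \<open>s\<close>.
  The predicate \<open>P\<close> carries the bound on \<open>m\<close> through the
  induction.\<close>

lemma decyclable_within_delete_in_neighbours:
  assumes "finite V" and "asym r" and "x \<in> V"
    and "{u \<in> V. (u, x) \<in> r} = B" and "V - B - {x} = A"
    and "\<And>s. asym s \<Longrightarrow> \<exists>m. decyclable_within A s m \<and> P m"
  shows "\<exists>m. decyclable_within V r (m + card B) \<and> P m"
  using assms
proof (induction "card B" arbitrary: V r B)
  case 0
  then have "B = {}" by auto
  then have "A = V - {x}" using "0.prems"(5) by simp
  with "0.prems"(6)[OF "0.prems"(2)] obtain m where "decyclable_within (V - {x}) r m" "P m"
    by blast
  from this(1) have "decyclable_within V r m"
    by (rule decyclable_within_add_source) (use \<open>B = {}\<close> "0.prems"(4) in auto)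
  with \<open>P m\<close> \<open>B = {}\<close> show ?case by auto
next
  case (Suc k)
  from Suc.hyps(2) have "B \<noteq> {}" by auto
  then obtain b where "b \<in> B" by blast
  then have b: "b \<in> V" "(b, x) \<in> r" using Suc.prems(4) by auto
  have "finite B" using Suc.prems(1,4) by auto
  have k: "k = card (B - {b})" using Suc.hyps(2) \<open>b \<in> B\<close> \<open>finite B\<close> by simp
  have "b \<noteq> x" using asymD[OF Suc.prems(2)] b(2) by blast
  let ?s = "reverse_within r (insert b {u \<in> V. (u, b) \<in> r})"
  \<comment> \<open>As \<open>b\<close> dominates \<open>x\<close>, asymmetry keeps \<open>x\<close>
    out of the inverted set, so all pairs at \<open>x\<close> survive.\<close>
  have in_nbrs: "{u \<in> V - {b}. (u, x) \<in> ?s} = B - {b}"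
    using Suc.prems(4) b(2) \<open>b \<noteq> x\<close> asymD[OF Suc.prems(2)]
    by (auto simp: mem_reverse_within split: if_splits)
  have rest: "V - {b} - (B - {b}) - {x} = A" using Suc.prems(5) \<open>b \<in> B\<close> by auto
  have "\<exists>m. decyclable_within (V - {b}) ?s (m + card (B - {b})) \<and> P m"
  proof (rule Suc.hyps(1)[OF k _ asym_reverse_within[OF Suc.prems(2)] _ in_nbrs rest])
    show "finite (V - {b})" "x \<in> V - {b}" using Suc.prems(1,3) \<open>b \<noteq> x\<close> by simp_all
  qed (rule Suc.prems(6))
  then obtain m where m: "decyclable_within (V - {b}) ?s (m + k)" "P m"
    unfolding k[symmetric] by blast
  from decyclable_within_delete_vertex[OF Suc.prems(2) b(1) m(1)]
  have "decyclable_within V r (m + card B)" by (simp flip: Suc.hyps(2))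
  with m(2) show ?case by blast
qed

text \<open>Double counting: if every in-degree were at least half of \<open>card V\<close>, the
  pairs of \<open>r\<close> in \<open>V\<close> and their converses, which are disjoint, would fill
  \<open>V \<times> V\<close>, yet they miss the diagonal.\<close>

lemma asym_ex_small_in_degree:
  assumes "finite V" and "V \<noteq> {}" and "asym r"
  shows "\<exists>x\<in>V. 2 * card {u \<in> V. (u, x) \<in> r} < card V"
proof (rule ccontr)
  assume neg: "\<not> ?thesis"
  define S where "S = (SIGMA x:V. {u \<in> V. (u, x) \<in> r})"
  have "finite S" using assms(1) by (simp add: S_def)
  have sub: "S \<union> S\<inverse> \<subseteq> V \<times> V" by (auto simp: S_def)
  have "S \<inter> S\<inverse> = {}" using asymD[OF assms(3)] by (auto simp: S_def)
  then have "card (S \<union> S\<inverse>) = 2 * card S"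
    using \<open>finite S\<close> by (simp add: card_Un_disjoint card_inverse)
  also have "card S = (\<Sum>x\<in>V. card {u \<in> V. (u, x) \<in> r})"
    using assms(1) by (simp add: S_def)
  also have "2 * \<dots> = (\<Sum>x\<in>V. 2 * card {u \<in> V. (u, x) \<in> r})"
    by (simp add: sum_distrib_left)
  also have "\<dots> \<ge> (\<Sum>x\<in>V. card V)"
    using neg by (intro sum_mono) auto
  finally have "card (V \<times> V) \<le> card (S \<union> S\<inverse>)"
    by (simp add: card_cartesian_product)
  then have "S \<union> S\<inverse> = V \<times> V"
    using sub assms(1) by (intro card_seteq) auto
  moreover obtain x where "x \<in> V" using assms(2) by blast
  moreover have "(x, x) \<notin> S \<union> S\<inverse>" using asymD[OF assms(3)] by (auto simp: S_def)
  ultimately show False by blast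
qed

text \<open>With \<open>k = card V - m\<close> the number of inversions saved, the last conjunct is
  a logarithm-free form of \<open>k \<ge> \<lceil>log 2 (card V + 1)\<rceil>\<close>.\<close>

lemma ex_decyclable_within:
  assumes "finite V" and "asym r"
  shows "\<exists>m. decyclable_within V r m \<and> m \<le> card V \<and> card V < 2 ^ (card V - m)"
  using assms
proof (induction "card V" arbitrary: V r rule: less_induct)
  case less
  show ?case
  proof (cases "V = {}")
    case True
    have "decyclable_within V r 0"
      unfolding decyclable_within_def by (intro exI[of _ "[]"]) (simp add: True acyclic_def)
    then show ?thesis using True by auto
  next
    case False
    then obtain x where x: "x \<in> V" and deg: "2 * card {u \<in> V. (u, x) \<in> r} < card V"
      using asym_ex_small_in_degree[OF less.prems(1) _ less.prems(2)] by blast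
    define B where "B = {u \<in> V. (u, x) \<in> r}"
    define A where "A = V - B - {x}"
    have "x \<notin> B" using asymD[OF less.prems(2)] by (auto simp: B_def)
    then have "V = insert x (B \<union> A)" "x \<notin> B \<union> A" "B \<inter> A = {}" "finite A" "finite B"
      using x less.prems(1) by (auto simp: A_def B_def)
    then have card_V: "card V = Suc (card B + card A)"
      by (simp add: card_Un_disjoint)
    have "\<exists>m. decyclable_within V r (m + card B) \<and> (m \<le> card A \<and> card A < 2 ^ (card A - m))"
      by (rule decyclable_within_delete_in_neighbours[OF less.prems x B_def[symmetric]
            A_def[symmetric]])
        (use less.hyps[of A] card_V \<open>finite A\<close> in auto)
    then obtain m where m: "decyclable_within V r (m + card B)" "m \<le> card A"
      "card A < 2 ^ (card A - m)" by blast
    \<comment> \<open>One more inversion is saved: \<open>card B + 1\<close> vertices go at the cost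
      of \<open>card B\<close> inversions.\<close>
    have "card V - (m + card B) = Suc (card A - m)" using card_V m(2) by simp
    \<comment> \<open>The degree bound gives \<open>card B \<le> card A\<close>, so
      \<open>card V \<le> 2 * card A + 1\<close>.\<close>
    moreover have "card V < 2 * 2 ^ (card A - m)"
      using deg card_V m(3) unfolding B_def[symmetric] by linarith
    ultimately show ?thesis using m(1,2) card_V by (intro exI[of _ "m + card B"]) auto
  qed
qed

lemma inv_number_upper_bound:
  assumes "oriented_graph D"
  shows "inv_number D \<le> card (pverts D)"
    and "card (pverts D) < 2 ^ (card (pverts D) - inv_number D)"
proof -
  interpret oriented_graph D by fact
  let ?n = "card (pverts D)"
  have "asym (parcs D)" using no_antiparallel by (auto intro: asymI)
  from ex_decyclable_within[OF pair_finite_verts this] obtain Xs where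
    Xs: "\<forall>X\<in>set Xs. X \<subseteq> pverts D" "length Xs \<le> ?n" "?n < 2 ^ (?n - length Xs)"
      "acyclic (foldl reverse_within (parcs D) Xs \<inter> pverts D \<times> pverts D)"
    unfolding decyclable_within_def by blast
  interpret I: oriented_graph "Inv D Xs" by (rule oriented_graph_Inv) fact
  have "pverts (Inv D Xs) = pverts D"
    unfolding Inv_def by (induction Xs rule: rev_induct) simp_all
  then have "parcs (Inv D Xs) \<subseteq> pverts D \<times> pverts D"
    using I.in_arcsD1 I.in_arcsD2 by auto
  then have "acyclic (parcs (Inv D Xs))"
    using Xs(4) by (simp add: parcs_Inv Int_absorb2)
  then have "decycling_family D Xs"
    using Xs(1) acyclic_Inv_iff[OF assms] by (simp add: decycling_family_def)
  then have le: "inv_number D \<le> length Xs"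
    unfolding inv_number_def by (intro Least_le) blast
  with Xs(2) show "inv_number D \<le> ?n" by simp
  have "(2::nat) ^ (?n - length Xs) \<le> 2 ^ (?n - inv_number D)"
    using le by (intro power_increasing) auto
  with Xs(3) show "?n < 2 ^ (?n - inv_number D)" by (rule less_le_trans)
qed

theorem theorem1p4:
  fixes n :: nat
  assumes "n > 0"
  shows "int (max_inv_number n) \<le> int n - \<lceil>log 2 (real n + 1)\<rceil>"
proof -
  have "max_inv_number n \<in>
      {inv_number D | D :: nat pair_pre_digraph. oriented_graph D \<and> card (pverts D) = n}"
    unfolding max_inv_number_def by (intro Max_in inv_number_values)
  then obtain D :: "nat pair_pre_digraph" where D: "oriented_graph D" "card (pverts D) = n"
    "max_inv_number n = inv_number D" by auto
  let ?m = "max_inv_number n"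
  have "?m \<le> n" and "n < 2 ^ (n - ?m)"
    using inv_number_upper_bound[OF D(1)] D(2,3) by auto
  \<comment> \<open>Strictness between integers supplies the \<open>+ 1\<close> inside the
    logarithm.\<close>
  then have "real (n + 1) \<le> real (2 ^ (n - ?m))" by (intro of_nat_mono) simp
  then have "real n + 1 \<le> 2 powr real (n - ?m)"
    by (simp add: powr_realpow)
  then have "log 2 (real n + 1) \<le> real (n - ?m)"
    by (simp add: log_le_iff)
  then have "\<lceil>log 2 (real n + 1)\<rceil> \<le> int n - int ?m"
    using \<open>?m \<le> n\<close> by (simp add: ceiling_le_iff of_nat_diff)
  then show ?thesis by simp
qed

end
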